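(* Let $K$ be a finite collection of ribbon nerves that are closed, convex complexes in Euclidean space. Then the nerve $\mathrm{Nrv}\,K$ of the collection $K$ (whose simplices are the nonempty subcollections of $K$ with nonempty common intersection) and the union of the ribbon nerves in $K$ have the same homotopy type.
   Context: A filled cycle $\mathrm{cyc}\,A$ is the part of the plane consisting of a simple closed curve (containing a finite, nonempty, path-connected collection of vertices of a planar CW space) together with everything inside it; $\mathrm{cl}$, $\mathrm{int}$ denote closure and interior. Given filled cycles $\mathrm{cyc}\,A,\mathrm{cyc}\,B$ with $\mathrm{cyc}\,B$ contained entirely in the interior of $\mathrm{cyc}\,A$, the associated planar ribbon is $\mathrm{cl}(\mathrm{cyc}\,A)\setminus\mathrm{int}(\mathrm{cyc}\,B)$. A ribbon nerve is a nonempty collection of planar ribbons (members of a countable collection of ribbons) with nonempty common intersection; as a subset of Euclidean space it is identified with the union of its ribbons, and it is called closed, convex if that subset is. For a finite nonempty collection $F$ of sets, $\mathrm{Nrv}\,F=\{X\subseteq F: X\neq\emptyset,\ \bigcap X\neq\emptyset\}$, regarded as an abstract simplicial complex; its homotopy type is that of its geometric realization. *)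

theory Defs
  imports "HOL-Analysis.Analysis"
begin

section \<open>CW complexes in the plane\<close>

definition closed_disk :: "nat \<Rightarrow> (nat \<Rightarrow> real) topology" where
  "closed_disk n = subtopology (Euclidean_space n) {x. (\<Sum>i<n. (x i)\<^sup>2) \<le> 1}"

text \<open>
  \<open>C n\<close> is the set of open \<open>n\<close>-cells. The four groups of conditions are: Hausdorff space
  partitioned into the cells; characteristic maps; closure-finiteness (the boundary of an
  \<open>n\<close>-cell lies in finitely many cells of lower dimension); weak topology.
  For \<open>n = 0\<close> the disk is a single point with empty boundary, so 0-cells are singletons.
\<close>

definition cw_complex :: "'a topology \<Rightarrow> (nat \<Rightarrow> 'a set set) \<Rightarrow> bool" where
  "cw_complex X C \<longleftrightarrow>
     Hausdorff_space X \<and>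
     topspace X = (\<Union>n. \<Union>(C n)) \<and>
     (\<forall>m n. \<forall>d\<in>C m. \<forall>e\<in>C n. (m, d) \<noteq> (n, e) \<longrightarrow> disjnt d e) \<and>
     (\<forall>n. \<forall>e\<in>C n. \<exists>\<phi>.
        continuous_map (closed_disk n) X \<phi> \<and>
        homeomorphic_map (subtopology (closed_disk n) {x. (\<Sum>i<n. (x i)\<^sup>2) < 1})
                         (subtopology X e) \<phi> \<and>
        (\<exists>F. finite F \<and> F \<subseteq> (\<Union>m<n. C m) \<and>
             \<phi> ` {x \<in> topspace (closed_disk n). (\<Sum>i<n. (x i)\<^sup>2) = 1} \<subseteq> \<Union>F)) \<and>
     (\<forall>A \<subseteq> topspace X.
        (\<forall>n. \<forall>e\<in>C n. closedin X (A \<inter> X closure_of e)) \<longrightarrow> closedin X A)"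

definition cw_space :: "(nat \<Rightarrow> 'a set set) \<Rightarrow> 'a set" where
  "cw_space C = (\<Union>n. \<Union>(C n))"

definition cw_vertices :: "(nat \<Rightarrow> 'a set set) \<Rightarrow> 'a set" where
  "cw_vertices C = \<Union>(C 0)"

text \<open>The plane is the type \<^typ>\<open>complex\<close>.\<close>

definition planar_cw_complex :: "(nat \<Rightarrow> complex set set) \<Rightarrow> bool" where
  "planar_cw_complex C \<longleftrightarrow> cw_complex (top_of_set (cw_space C)) C"


section \<open>Filled cycles, ribbons and ribbon nerves\<close>

text \<open>
  \<open>S\<close> is a filled cycle on the vertices \<open>A\<close>: a simple closed curve through \<open>A\<close> together with
  its inside. Path-connectedness of the finite vertex set \<open>A\<close> means that any two of its
  vertices are joined by a path in the CW space; \<open>A\<close> itself is in general not a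
  path-connected subset of the plane.
\<close>

definition filled_cycle :: "(nat \<Rightarrow> complex set set) \<Rightarrow> complex set \<Rightarrow> complex set \<Rightarrow> bool" where
  "filled_cycle C A S \<longleftrightarrow>
     finite A \<and> A \<noteq> {} \<and> A \<subseteq> cw_vertices C \<and>
     (\<forall>v\<in>A. \<forall>w\<in>A. path_component (cw_space C) v w) \<and>
     (\<exists>\<gamma>. simple_path \<gamma> \<and> pathfinish \<gamma> = pathstart \<gamma> \<and> A \<subseteq> path_image \<gamma> \<and>
          S = path_image \<gamma> \<union> inside (path_image \<gamma>))"

definition planar_ribbon :: "(nat \<Rightarrow> complex set set) \<Rightarrow> complex set \<Rightarrow> bool" where
  "planar_ribbon C r \<longleftrightarrow>
     (\<exists>A B cycA cycB. filled_cycle C A cycA \<and> filled_cycle C B cycB \<and>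
        cycB \<subseteq> interior cycA \<and> r = closure cycA - interior cycB)"

text \<open>\<open>R\<close> is the ambient collection of ribbons; the subset of the plane underlying a ribbon
  nerve \<open>N\<close> is \<open>\<Union>N\<close>.\<close>

definition ribbon_nerve :: "complex set set \<Rightarrow> complex set set \<Rightarrow> bool" where
  "ribbon_nerve R N \<longleftrightarrow> N \<noteq> {} \<and> N \<subseteq> R \<and> \<Inter>N \<noteq> {}"


section \<open>Nerves and geometric realization\<close>

text \<open>
  The members of \<open>F\<close> are the vertices and \<open>u x\<close> is the point set with which the member \<open>x\<close>
  is identified; for a family of sets, \<open>u\<close> is the identity.
\<close>

definition Nrv :: "('v \<Rightarrow> 'a set) \<Rightarrow> 'v set \<Rightarrow> 'v set set" where
  "Nrv u F = {X. X \<subseteq> F \<and> X \<noteq> {} \<and> (\<Inter>x\<in>X. u x) \<noteq> {}}"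

text \<open>
  Geometric realization of an abstract simplicial complex with finitely many vertices, by
  barycentric coordinates. The topology is that of pointwise convergence, which for a finite
  complex is the usual (coherent) topology of the realization.
\<close>

definition geometric_realization :: "'v set set \<Rightarrow> ('v \<Rightarrow> real) topology" where
  "geometric_realization \<S> =
     subtopology (powertop_real UNIV)
       {t. (\<forall>v. 0 \<le> t v) \<and> {v. t v \<noteq> 0} \<in> \<S> \<and> (\<Sum>v | t v \<noteq> 0. t v) = 1}"

end

theory Submission
  imports Defs
begin

text \<open>
  Only closedness and convexity of finitely many nonempty sets \<open>U i\<close> with union \<open>X\<close> matter.
  A map \<open>g\<close> from \<open>X\<close> to the realization is given by normalizing
  \<open>max 0 (e x - infdist x (U i))\<close>, where the continuous margin \<open>e > 0\<close> is so small that the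
  support is always a simplex; the largest coordinates of \<open>g x\<close> are those with \<open>x \<in> U i\<close>.
  A map \<open>f\<close> back to \<open>X\<close> is given by convex combinations of points chosen in the
  intersections, arranged so that \<open>f t \<in> U i\<close> whenever the coordinate \<open>t i\<close> is maximal.
  Then \<open>f (g x)\<close> and \<open>x\<close> lie in a common convex set \<open>U i\<close>, and \<open>g (f t)\<close> and \<open>t\<close> have a
  common nonzero coordinate, which is enough for both composites to be homotopic to the
  identity.
\<close>

section \<open>Barycentric coordinates and homotopies of maps into a realization\<close>

definition barycentric_points :: "'v set set \<Rightarrow> ('v \<Rightarrow> real) set" where
  "barycentric_points S =
     {t. (\<forall>v. 0 \<le> t v) \<and> {v. t v \<noteq> 0} \<in> S \<and> (\<Sum>v | t v \<noteq> 0. t v) = 1}"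

text \<open>The product topology on a function type is its type class topology, so maps to and from
  the realization can be treated with \<open>continuous_on\<close>.\<close>

lemma geometric_realization_eq:
  "geometric_realization S = top_of_set (barycentric_points S)"
  unfolding geometric_realization_def barycentric_points_def euclidean_product_topology ..

text \<open>Summing over the fixed set \<open>K\<close> instead of the varying support makes the
  normalization condition linear in \<open>t\<close>.\<close>

lemma barycentric_points_iff:
  assumes "finite K" "S \<subseteq> Pow K"
  shows "t \<in> barycentric_points S \<longleftrightarrow>
           (\<forall>v. 0 \<le> t v) \<and> {v. t v \<noteq> 0} \<in> S \<and> sum t K = 1"
proof -
  have "(\<Sum>v | t v \<noteq> 0. t v) = sum t K" if "{v. t v \<noteq> 0} \<in> S"
    using that assms by (intro sum.mono_neutral_left) auto
  then show ?thesis
    by (auto simp: barycentric_points_def)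
qed

lemma normalize_in_barycentric_points:
  fixes t :: "'v \<Rightarrow> real"
  assumes "finite K" "S \<subseteq> Pow K" "{v. t v \<noteq> 0} \<in> S" "\<And>v. 0 \<le> t v" "sum t K > 0"
  shows "(\<lambda>v. t v / sum t K) \<in> barycentric_points S"
  using assms by (auto simp: barycentric_points_iff sum_divide_distrib[symmetric])

text \<open>The straight line from \<open>f x\<close> to \<open>g x\<close> works: for
  \<open>s > 0\<close> its point has exactly the support of \<open>g x\<close>, since all
  coordinates are nonnegative, and at \<open>s = 0\<close> it is \<open>f x\<close> itself.\<close>

lemma homotopic_barycentric_points_face:
  fixes f g :: "'a::topological_space \<Rightarrow> 'v \<Rightarrow> real"
  assumes K: "finite K" "S \<subseteq> Pow K"
    and f: "continuous_on X f" "f \<in> X \<rightarrow> barycentric_points S"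
    and g: "continuous_on X g" "g \<in> X \<rightarrow> barycentric_points S"
    and face: "\<And>x v. \<lbrakk>x \<in> X; f x v \<noteq> 0\<rbrakk> \<Longrightarrow> g x v \<noteq> 0"
  shows "homotopic_with_canon (\<lambda>_. True) X (barycentric_points S) f g"
proof -
  define H where "H = (\<lambda>(s, x) v. (1 - s) * f x v + s * g x v)"
  have "continuous_on ({0..1} \<times> X) H"
  proof (rule continuous_on_coordinatewise_then_product)
    fix v
    have "continuous_on X (\<lambda>x. f x v)" "continuous_on X (\<lambda>x. g x v)"
      using f g by (auto intro: continuous_on_product_then_coordinatewise)
    then have "continuous_on ({0..1} \<times> X) (\<lambda>p. f (snd p) v)"
              "continuous_on ({0..1} \<times> X) (\<lambda>p. g (snd p) v)"
      by (auto intro!: continuous_on_compose2[of X _ _ snd] continuous_intros)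
    then show "continuous_on ({0..1} \<times> X) (\<lambda>p. H p v)"
      by (auto simp: H_def case_prod_unfold intro!: continuous_intros)
  qed
  moreover have "H (s, x) \<in> barycentric_points S" if "s \<in> {0..1}" "x \<in> X" for s x
  proof (cases "s = 0")
    case True
    then show ?thesis using f that by (auto simp: H_def)
  next
    case False
    have fx: "f x \<in> barycentric_points S" and gx: "g x \<in> barycentric_points S"
      using f g that by auto
    note bary = fx[unfolded barycentric_points_iff[OF K]] gx[unfolded barycentric_points_iff[OF K]]
    have "H (s, x) v \<noteq> 0 \<longleftrightarrow> g x v \<noteq> 0" for v
    proof (cases "g x v = 0")
      case True
      then have "f x v = 0" using face that by blast
      then show ?thesis using True by (simp add: H_def)
    next
      case nz: False
      then have "g x v > 0" using bary by (metis order_le_less)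
      then have "s * g x v > 0" "(1 - s) * f x v \<ge> 0"
        using False that bary by auto
      then show ?thesis using nz by (auto simp: H_def)
    qed
    moreover have "sum (H (s, x)) K = 1"
      using bary by (simp add: H_def sum.distrib flip: sum_distrib_left)
    moreover have "0 \<le> H (s, x) v" for v
      using that bary by (auto simp: H_def)
    ultimately show ?thesis
      using bary by (simp add: barycentric_points_iff[OF K])
  qed
  moreover have "H (0, x) = f x" "H (1, x) = g x" for x
    by (auto simp: H_def)
  ultimately show ?thesis
    unfolding homotopic_with_def
    by (intro exI[of _ H]) (auto simp: prod_topology_subtopology_eu)
qed

text \<open>The normalized minimum of the two maps is supported on the common face of their carriers,
  so it is linearly homotopic to both.\<close>

lemma homotopic_barycentric_points:
  fixes f g :: "'a::topological_space \<Rightarrow> 'v \<Rightarrow> real"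
  assumes K: "finite K" "S \<subseteq> Pow K"
    and down: "\<And>A B. \<lbrakk>A \<in> S; B \<subseteq> A; B \<noteq> {}\<rbrakk> \<Longrightarrow> B \<in> S"
    and f: "continuous_on X f" "f \<in> X \<rightarrow> barycentric_points S"
    and g: "continuous_on X g" "g \<in> X \<rightarrow> barycentric_points S"
    and meet: "\<And>x. x \<in> X \<Longrightarrow> \<exists>v. f x v \<noteq> 0 \<and> g x v \<noteq> 0"
  shows "homotopic_with_canon (\<lambda>_. True) X (barycentric_points S) f g"
proof -
  define m where "m = (\<lambda>x v. min (f x v) (g x v))"
  define h where "h = (\<lambda>x v. m x v / sum (m x) K)"
  have bary: "\<forall>v. 0 \<le> f x v" "{v. f x v \<noteq> 0} \<in> S" "\<forall>v. 0 \<le> g x v" "{v. g x v \<noteq> 0} \<in> S"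
    if "x \<in> X" for x
    using f g that by (auto simp: barycentric_points_iff[OF K] Pi_iff)
  have m_nonneg: "0 \<le> m x v" if "x \<in> X" for x v
    using bary that by (auto simp: m_def)
  have m_supp: "m x v \<noteq> 0 \<longleftrightarrow> f x v \<noteq> 0 \<and> g x v \<noteq> 0" if "x \<in> X" for x v
    using bary(1,3)[OF that] by (auto simp: m_def min_def) (metis order_antisym)+
  have m_sum: "sum (m x) K > 0" if x: "x \<in> X" for x
  proof -
    \<comment> \<open>The common nonzero coordinate keeps the sum positive, which makes the division
      in \<open>h\<close> meaningful.\<close>
    obtain v where v: "m x v \<noteq> 0"
      using meet[OF x] m_supp[OF x] by blast
    then have "v \<in> K" using m_supp bary K x by blast
    with v show ?thesis
      using m_nonneg[OF x] K by (intro sum_pos2[of K v]) (auto simp: order_less_le)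
  qed
  have h_bary: "h \<in> X \<rightarrow> barycentric_points S"
  proof
    fix x assume x: "x \<in> X"
    have "{v. m x v \<noteq> 0} \<in> S"
    proof (rule down)
      show "{v. f x v \<noteq> 0} \<in> S" by (rule bary[OF x])
      show "{v. m x v \<noteq> 0} \<subseteq> {v. f x v \<noteq> 0}" "{v. m x v \<noteq> 0} \<noteq> {}"
        unfolding m_supp[OF x] using meet[OF x] by blast+
    qed
    then show "h x \<in> barycentric_points S"
      unfolding h_def
      by (intro normalize_in_barycentric_points) (use K x m_nonneg m_sum in auto)
  qed
  have m_cont: "continuous_on X (\<lambda>x. m x v)" for v
    using f(1) g(1) unfolding m_def
    by (auto intro!: continuous_intros intro: continuous_on_product_then_coordinatewise)
  have "continuous_on X h"
    unfolding h_def
    by (rule continuous_on_coordinatewise_then_product)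
       (use m_sum in \<open>force intro!: continuous_intros m_cont\<close>)
  then have "homotopic_with_canon (\<lambda>_. True) X (barycentric_points S) h f"
            "homotopic_with_canon (\<lambda>_. True) X (barycentric_points S) h g"
    using f g h_bary m_supp
    by (intro homotopic_barycentric_points_face[OF K]; auto simp: h_def)+
  then show ?thesis
    using homotopic_with_sym homotopic_with_trans by blast
qed

section \<open>Maps between a finite closed convex cover and its nerve\<close>

lemma finite_family_positive_lower_bound:
  fixes h :: "'i \<Rightarrow> 'a::topological_space \<Rightarrow> real"
  assumes "finite I"
    and "\<And>i. i \<in> I \<Longrightarrow> continuous_on X (h i)"
    and "\<And>i x. \<lbrakk>i \<in> I; x \<in> X\<rbrakk> \<Longrightarrow> h i x > 0"
  obtains e where "continuous_on X e" "\<And>x. x \<in> X \<Longrightarrow> e x > 0"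
    "\<And>i x. \<lbrakk>i \<in> I; x \<in> X\<rbrakk> \<Longrightarrow> e x \<le> h i x"
proof -
  have "\<exists>e. continuous_on X e \<and> (\<forall>x\<in>X. e x > 0 \<and> (\<forall>i\<in>I. e x \<le> h i x))"
    using assms
  proof (induction I rule: finite_induct)
    case empty
    show ?case by (intro exI[of _ "\<lambda>_. 1"]) auto
  next
    case (insert i I)
    then obtain e where "continuous_on X e" "\<forall>x\<in>X. e x > 0 \<and> (\<forall>i\<in>I. e x \<le> h i x)"
      by auto
    with insert.prems show ?case
      by (intro exI[of _ "\<lambda>x. min (e x) (h i x)"])
         (auto intro!: continuous_intros simp: min_le_iff_disj)
  qed
  with that show thesis by blast
qed

text \<open>If the members of \<open>\<sigma>\<close> have no common point, then every
  \<open>x\<close> misses one of them and, by closedness, has positive distance from it. There are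
  finitely many such \<open>\<sigma>\<close>, so one continuous margin serves them all.\<close>

lemma closed_cover_margin:
  fixes U :: "'v \<Rightarrow> 'a::metric_space set"
  assumes K: "finite K"
    and closed: "\<And>i. i \<in> K \<Longrightarrow> closed (U i)"
    and nonempty: "\<And>i. i \<in> K \<Longrightarrow> U i \<noteq> {}"
  obtains e where "continuous_on UNIV e" "\<And>x. e x > 0"
    "\<And>x \<sigma>. \<lbrakk>\<sigma> \<subseteq> K; \<sigma> \<noteq> {}; \<And>i. i \<in> \<sigma> \<Longrightarrow> infdist x (U i) < e x\<rbrakk> \<Longrightarrow> \<sigma> \<in> Nrv U K"
proof -
  define bad where "bad = {\<sigma>. \<sigma> \<subseteq> K \<and> \<sigma> \<noteq> {} \<and> \<sigma> \<notin> Nrv U K}"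
  \<comment> \<open>The average is chosen because it is below \<open>e x\<close> as soon as every
    single distance is; this contradicts \<open>e x \<le> h \<sigma> x\<close> for a bad
    \<open>\<sigma>\<close>.\<close>
  define h where "h = (\<lambda>\<sigma> x. (\<Sum>i\<in>\<sigma>. infdist x (U i)) / card \<sigma>)"
  have h_pos: "h \<sigma> x > 0" if \<sigma>: "\<sigma> \<in> bad" for \<sigma> x
  proof -
    have fin: "finite \<sigma>" using \<sigma> K finite_subset unfolding bad_def by blast
    obtain i where i: "i \<in> \<sigma>" "x \<notin> U i"
      using \<sigma> by (auto simp: bad_def Nrv_def)
    then have "i \<in> K" using \<sigma> unfolding bad_def by blast
    then have "infdist x (U i) > 0"
      using infdist_pos_not_in_closed[OF closed nonempty] i by blast
    then have "(\<Sum>i\<in>\<sigma>. infdist x (U i)) > 0"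
      using fin i by (intro sum_pos2[of \<sigma> i]) (auto simp: infdist_nonneg)
    then show ?thesis
      using fin i by (auto simp: h_def card_gt_0_iff intro!: divide_pos_pos)
  qed
  have "finite bad" using K unfolding bad_def by simp
  moreover have "continuous_on UNIV (h \<sigma>)" if "\<sigma> \<in> bad" for \<sigma>
    unfolding h_def divide_inverse by (intro continuous_intros)
  ultimately obtain e where e: "continuous_on UNIV e" "\<And>x. e x > 0"
      "\<And>\<sigma> x. \<sigma> \<in> bad \<Longrightarrow> e x \<le> h \<sigma> x"
    using finite_family_positive_lower_bound[of bad UNIV h] h_pos by auto
  have "\<sigma> \<in> Nrv U K"
    if \<sigma>: "\<sigma> \<subseteq> K" "\<sigma> \<noteq> {}" and close: "\<And>i. i \<in> \<sigma> \<Longrightarrow> infdist x (U i) < e x" for x \<sigma>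
  proof (rule ccontr)
    assume "\<sigma> \<notin> Nrv U K"
    with \<sigma> have "\<sigma> \<in> bad" by (simp add: bad_def)
    have card: "card \<sigma> > 0" using \<sigma> K finite_subset card_gt_0_iff by blast
    have "(\<Sum>i\<in>\<sigma>. infdist x (U i)) < of_nat (card \<sigma>) * e x"
      using close card by (intro sum_bounded_above_strict)
    also have "\<dots> \<le> of_nat (card \<sigma>) * h \<sigma> x"
      using e(3)[OF \<open>\<sigma> \<in> bad\<close>] by (intro mult_left_mono) auto
    also have "\<dots> = (\<Sum>i\<in>\<sigma>. infdist x (U i))"
      using card by (simp add: h_def)
    finally show False by simp
  qed
  with e that show thesis by blast
qed

lemma closed_cover_to_nerve:
  fixes U :: "'v \<Rightarrow> 'a::metric_space set"
  assumes K: "finite K"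
    and closed: "\<And>i. i \<in> K \<Longrightarrow> closed (U i)"
    and nonempty: "\<And>i. i \<in> K \<Longrightarrow> U i \<noteq> {}"
  obtains g where "continuous_on (\<Union>i\<in>K. U i) g"
    "g \<in> (\<Union>i\<in>K. U i) \<rightarrow> barycentric_points (Nrv U K)"
    "\<And>x i. \<lbrakk>i \<in> K; x \<in> U i\<rbrakk> \<Longrightarrow> g x i \<noteq> 0"
    "\<And>x i j. \<lbrakk>i \<in> K; x \<notin> U i; j \<in> K; x \<in> U j\<rbrakk> \<Longrightarrow> g x i < g x j"
proof -
  obtain e where e: "continuous_on UNIV e" "\<And>x. e x > 0"
    "\<And>x \<sigma>. \<lbrakk>\<sigma> \<subseteq> K; \<sigma> \<noteq> {}; \<And>i. i \<in> \<sigma> \<Longrightarrow> infdist x (U i) < e x\<rbrakk> \<Longrightarrow> \<sigma> \<in> Nrv U K"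
    using closed_cover_margin[where K = K and U = U, OF assms] by blast
  \<comment> \<open>For \<open>i\<close> in \<open>K\<close>, the upper bound \<open>e x\<close> of
    \<open>\<phi> x i\<close> is attained exactly when \<open>x\<close> lies in the closed set
    \<open>U i\<close>. Dividing by a common positive sum preserves this order of the
    coordinates.\<close>
  define \<phi> where "\<phi> = (\<lambda>x i. if i \<in> K then max 0 (e x - infdist x (U i)) else 0)"
  define g where "g = (\<lambda>x i. \<phi> x i / sum (\<phi> x) K)"
  have \<phi>_nonneg: "0 \<le> \<phi> x i" for x i
    by (simp add: \<phi>_def)
  have \<phi>_in: "\<phi> x i = e x" if "i \<in> K" "x \<in> U i" for x i
    using that e(2)[of x] by (simp add: \<phi>_def)
  have \<phi>_sum: "sum (\<phi> x) K > 0" if "i \<in> K" "x \<in> U i" for x i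
    using that \<phi>_in[OF that] e(2)[of x] \<phi>_nonneg K by (intro sum_pos2[of K i]) auto
  have \<phi>_cont: "continuous_on X (\<lambda>x. \<phi> x i)" for X i
    using continuous_on_subset[OF e(1)]
    by (cases "i \<in> K") (auto simp: \<phi>_def intro!: continuous_intros)
  show thesis
  proof
    show "continuous_on (\<Union>i\<in>K. U i) g"
      unfolding g_def
      by (rule continuous_on_coordinatewise_then_product)
         (use \<phi>_sum in \<open>force intro!: continuous_intros \<phi>_cont\<close>)
    show "g \<in> (\<Union>i\<in>K. U i) \<rightarrow> barycentric_points (Nrv U K)"
    proof
      fix x assume "x \<in> (\<Union>i\<in>K. U i)"
      then obtain i where i: "i \<in> K" "x \<in> U i" by blast
      then have "\<phi> x i \<noteq> 0" using \<phi>_in e(2)[of x] by simp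
      then have "{v. \<phi> x v \<noteq> 0} \<in> Nrv U K"
        by (intro e(3)[of _ x]) (auto simp: \<phi>_def split: if_splits)
      then show "g x \<in> barycentric_points (Nrv U K)"
        unfolding g_def using K \<phi>_nonneg \<phi>_sum[OF i]
        by (intro normalize_in_barycentric_points) (auto simp: Nrv_def)
    qed
    show "g x i \<noteq> 0" if "i \<in> K" "x \<in> U i" for x i
      using \<phi>_in[OF that] \<phi>_sum[OF that] e(2)[of x] by (simp add: g_def)
    show "g x i < g x j" if "i \<in> K" "x \<notin> U i" "j \<in> K" "x \<in> U j" for x i j
    proof -
      have "infdist x (U i) > 0"
        using closed nonempty that by (intro infdist_pos_not_in_closed) auto
      then have "\<phi> x i < \<phi> x j"
        using \<phi>_in[OF that(3,4)] e(2)[of x] that(1) by (auto simp: \<phi>_def)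
      then show ?thesis
        using \<phi>_sum[OF that(3,4)] by (simp add: g_def divide_strict_right_mono)
    qed
  qed
qed

text \<open>The weight of \<open>\<sigma>\<close> is nonzero exactly when every coordinate in \<open>\<sigma>\<close> is larger than every
  coordinate outside \<open>\<sigma>\<close>. Hence only simplices containing all maximal coordinates contribute.\<close>

lemma nerve_to_convex_cover:
  fixes U :: "'v \<Rightarrow> 'a::real_normed_vector set"
  assumes K: "finite K"
    and convex: "\<And>i. i \<in> K \<Longrightarrow> convex (U i)"
  obtains f where "continuous_on (barycentric_points (Nrv U K)) f"
    "\<And>t i. \<lbrakk>t \<in> barycentric_points (Nrv U K); i \<in> K; \<And>j. j \<in> K \<Longrightarrow> t j \<le> t i\<rbrakk> \<Longrightarrow> f t \<in> U i"
proof -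
  let ?N = "Nrv U K" and ?B = "barycentric_points (Nrv U K)"
  have N: "?N \<subseteq> Pow K" "finite ?N"
    using K finite_subset[of ?N "Pow K"] by (auto simp: Nrv_def)
  have "\<exists>p. p \<in> (\<Inter>i\<in>\<sigma>. U i)" if "\<sigma> \<in> ?N" for \<sigma>
    using that by (auto simp: Nrv_def)
  then obtain p where p: "\<And>\<sigma>. \<sigma> \<in> ?N \<Longrightarrow> p \<sigma> \<in> (\<Inter>i\<in>\<sigma>. U i)"
    by metis
  define w :: "('v \<Rightarrow> real) \<Rightarrow> 'v set \<Rightarrow> real"
    where "w = (\<lambda>t \<sigma>. \<Prod>i\<in>\<sigma>. \<Prod>j\<in>K - \<sigma>. max 0 (t i - t j))"
  define f where "f = (\<lambda>t. \<Sum>\<sigma>\<in>?N. (w t \<sigma> / sum (w t) ?N) *\<^sub>R p \<sigma>)"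
  have w_nonneg: "0 \<le> w t \<sigma>" for t \<sigma>
    unfolding w_def by (intro prod_nonneg) auto
  have w_max: "i \<in> \<sigma>"
    if \<sigma>: "\<sigma> \<in> ?N" "w t \<sigma> \<noteq> 0" and i: "i \<in> K" "\<And>j. j \<in> K \<Longrightarrow> t j \<le> t i" for t \<sigma> i
  proof (rule ccontr)
    assume "i \<notin> \<sigma>"
    obtain k where k: "k \<in> \<sigma>" "k \<in> K" using \<sigma>(1) unfolding Nrv_def by blast
    have "finite \<sigma>" using \<sigma>(1) N(1) K finite_subset by blast
    \<comment> \<open>This is the factor of \<open>w t \<sigma>\<close> for \<open>k\<close> inside
      and \<open>i\<close> outside \<open>\<sigma>\<close>; it vanishes because \<open>t i\<close>
      is maximal.\<close>
    then have "max 0 (t k - t i) \<noteq> 0"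
      using \<sigma>(2) i(1) k \<open>i \<notin> \<sigma>\<close> K by (auto simp: w_def)
    then show False using i(2)[OF k(2)] by auto
  qed
  have w_sum: "sum (w t) ?N > 0" if t: "t \<in> ?B" for t
  proof -
    have supp: "{v. t v \<noteq> 0} \<in> ?N" and nonneg: "\<forall>v. 0 \<le> t v"
      using t barycentric_points_iff[OF K N(1)] by auto
    then obtain v where v: "t v \<noteq> 0" "v \<in> K" by (auto simp: Nrv_def)
    \<comment> \<open>The set of coordinates attaining \<open>M\<close> provides a positive weight:
      \<open>M > 0\<close> makes it a face of the support of \<open>t\<close>, and all other
      coordinates are strictly smaller. If it is all of \<open>K\<close>, the inner products are
      empty and equal 1.\<close>
    define M where "M = Max (t ` K)"
    have M: "t j \<le> M" if "j \<in> K" for j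
      using K that by (simp add: M_def)
    have "M \<in> t ` K" unfolding M_def using K v by (intro Max_in) auto
    moreover have "M > 0" using M[OF v(2)] v(1) nonneg by (metis order_le_less order_less_le_trans)
    ultimately have "{i \<in> K. t i = M} \<noteq> {}" "{i \<in> K. t i = M} \<subseteq> {v. t v \<noteq> 0}"
      by auto
    with supp have N': "{i \<in> K. t i = M} \<in> ?N"
      unfolding Nrv_def by blast
    have "w t {i \<in> K. t i = M} > 0"
      unfolding w_def using M by (intro prod_pos) (force simp: order_less_le)
    with N' show ?thesis
      using N(2) w_nonneg by (intro sum_pos2[of ?N "{i \<in> K. t i = M}"])
  qed
  have "continuous_on ?B (\<lambda>t. t v)" for v :: 'v
    by (intro continuous_on_product_coordinates continuous_on_subset[OF _ subset_UNIV])
  then have "continuous_on ?B (\<lambda>t. w t \<sigma>)" for \<sigma>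
    unfolding w_def by (intro continuous_intros)
  then have "continuous_on ?B f"
    unfolding f_def using w_sum by (force intro!: continuous_intros)
  moreover have "f t \<in> U i" if t: "t \<in> ?B" and i: "i \<in> K" "\<And>j. j \<in> K \<Longrightarrow> t j \<le> t i" for t i
  proof -
    \<comment> \<open>Terms of weight zero are dropped, since only for the remaining
      \<open>\<sigma>\<close> is \<open>p \<sigma>\<close> known to lie in
      \<open>U i\<close>.\<close>
    let ?N' = "{\<sigma> \<in> ?N. w t \<sigma> \<noteq> 0}"
    have "f t = (\<Sum>\<sigma>\<in>?N'. (w t \<sigma> / sum (w t) ?N) *\<^sub>R p \<sigma>)"
      unfolding f_def using N(2) by (intro sum.mono_neutral_right) auto
    also have "\<dots> \<in> U i"
    proof (rule convex_sum)
      have "sum (w t) ?N' = sum (w t) ?N"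
        using N(2) by (intro sum.mono_neutral_left) auto
      then show "(\<Sum>\<sigma>\<in>?N'. w t \<sigma> / sum (w t) ?N) = 1"
        using w_sum[OF t] by (simp flip: sum_divide_distrib)
      show "p \<sigma> \<in> U i" if "\<sigma> \<in> ?N'" for \<sigma>
        using p[of \<sigma>] w_max[of \<sigma> t i] that i by auto
      show "0 \<le> w t \<sigma> / sum (w t) ?N" for \<sigma>
        using w_nonneg w_sum[OF t] by (simp add: order_less_imp_le)
    qed (use N(2) convex i in auto)
    finally show ?thesis .
  qed
  ultimately show thesis using that by blast
qed

section \<open>The nerve theorem and its application to ribbon nerves\<close>

text \<open>The cover is an indexed family, which allows different ribbon nerves to have the same
  union.\<close>

theorem nerve_closed_convex_cover:
  fixes U :: "'v \<Rightarrow> 'a::real_normed_vector set"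
  assumes K: "finite K"
    and closed: "\<And>i. i \<in> K \<Longrightarrow> closed (U i)"
    and convex: "\<And>i. i \<in> K \<Longrightarrow> convex (U i)"
    and nonempty: "\<And>i. i \<in> K \<Longrightarrow> U i \<noteq> {}"
  shows "geometric_realization (Nrv U K) homotopy_equivalent_space top_of_set (\<Union>i\<in>K. U i)"
proof -
  let ?N = "Nrv U K" and ?B = "barycentric_points (Nrv U K)" and ?X = "\<Union>i\<in>K. U i"
  obtain g where g: "continuous_on ?X g" "g \<in> ?X \<rightarrow> ?B"
    and g_in: "\<And>x i. \<lbrakk>i \<in> K; x \<in> U i\<rbrakk> \<Longrightarrow> g x i \<noteq> 0"
    and g_less: "\<And>x i j. \<lbrakk>i \<in> K; x \<notin> U i; j \<in> K; x \<in> U j\<rbrakk> \<Longrightarrow> g x i < g x j"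
    using closed_cover_to_nerve[where K = K and U = U, OF K closed nonempty] by blast
  obtain f where f: "continuous_on ?B f"
    and f_in: "\<And>t i. \<lbrakk>t \<in> ?B; i \<in> K; \<And>j. j \<in> K \<Longrightarrow> t j \<le> t i\<rbrakk> \<Longrightarrow> f t \<in> U i"
    using nerve_to_convex_cover[where K = K and U = U, OF K convex] by blast
  have N: "?N \<subseteq> Pow K"
    by (auto simp: Nrv_def)
  have peak: "\<exists>i\<in>K. t i \<noteq> 0 \<and> (\<forall>j\<in>K. t j \<le> t i)" if t: "t \<in> ?B" for t
  proof -
    have "{v. t v \<noteq> 0} \<in> ?N" and nonneg: "\<forall>v. 0 \<le> t v"
      using t barycentric_points_iff[OF K N] by auto
    then obtain v where v: "t v \<noteq> 0" "v \<in> K" by (auto simp: Nrv_def)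
    have "Max (t ` K) \<in> t ` K" using K v by (intro Max_in) auto
    then obtain i where i: "i \<in> K" "t i = Max (t ` K)" by force
    then have *: "\<forall>j\<in>K. t j \<le> t i" using K by simp
    then have "t i \<noteq> 0" using v nonneg by (metis order_antisym)
    with i * show ?thesis by blast
  qed
  have f_B: "f \<in> ?B \<rightarrow> ?X"
  proof
    fix t assume t: "t \<in> ?B"
    then obtain i where "i \<in> K" "\<forall>j\<in>K. t j \<le> t i"
      using peak by blast
    then show "f t \<in> ?X"
      using f_in[OF t, of i] by blast
  qed
  have "homotopic_with_canon (\<lambda>_. True) ?B ?B (g \<circ> f) id"
  proof (rule homotopic_barycentric_points[OF K N])
    show "continuous_on ?B (g \<circ> f)"
      using f g(1) f_B by (intro continuous_on_compose continuous_on_subset[OF g(1)]) auto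
    show "\<exists>i. (g \<circ> f) t i \<noteq> 0 \<and> id t i \<noteq> 0" if t: "t \<in> ?B" for t
    proof -
      \<comment> \<open>A maximal coordinate \<open>i\<close> of \<open>t\<close> is the common one:
        it is nonzero in \<open>t\<close>, and \<open>f t \<in> U i\<close> makes it nonzero in
        \<open>g (f t)\<close>.\<close>
      obtain i where i: "i \<in> K" "t i \<noteq> 0" "\<forall>j\<in>K. t j \<le> t i"
        using peak[OF t] by blast
      then have "f t \<in> U i"
        using f_in[OF t, of i] by blast
      then show ?thesis
        using g_in[of i] i by auto
    qed
    show "B \<in> ?N" if "A \<in> ?N" "B \<subseteq> A" "B \<noteq> {}" for A B
      using that unfolding Nrv_def by blast
    show "g \<circ> f \<in> ?B \<rightarrow> ?B"
      using g(2) f_B unfolding Pi_iff comp_apply by blast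
  qed auto
  moreover have "homotopic_with_canon (\<lambda>_. True) ?X ?X (f \<circ> g) id"
  proof (rule homotopic_with_linear)
    show "continuous_on ?X (f \<circ> g)"
      using f g by (intro continuous_on_compose continuous_on_subset[OF f]) auto
    fix x assume x: "x \<in> ?X"
    then have gx: "g x \<in> ?B" using g by auto
    obtain i where i: "i \<in> K" "\<forall>j\<in>K. g x j \<le> g x i"
      using peak[OF gx] by blast
    \<comment> \<open>Otherwise \<open>x\<close> lies in some other \<open>U j\<close>, and
      \<open>g x i < g x j\<close> contradicts the maximality of \<open>g x i\<close>.\<close>
    have "x \<in> U i"
      using x i g_less[of i x] by force
    moreover have "f (g x) \<in> U i"
      using f_in[OF gx] i by blast
    ultimately have "closed_segment (f (g x)) x \<subseteq> U i"
      using convex i by (intro closed_segment_subset)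
    then show "closed_segment ((f \<circ> g) x) (id x) \<subseteq> ?X"
      using i by auto
  qed auto
  ultimately show ?thesis
    unfolding geometric_realization_eq homotopy_equivalent_space_def
    using f f_B g by (intro exI[of _ f] exI[of _ g]) auto
qed

theorem theorem16:
  fixes C :: "nat \<Rightarrow> complex set set"
    and R :: "complex set set"
    and K :: "complex set set set"
  assumes "planar_cw_complex C"
    and "countable R"
    and "\<And>r. r \<in> R \<Longrightarrow> planar_ribbon C r"
    and "finite K"
    and "\<And>N. N \<in> K \<Longrightarrow> ribbon_nerve R N"
    and "\<And>N. N \<in> K \<Longrightarrow> closed (\<Union>N)"
    and "\<And>N. N \<in> K \<Longrightarrow> convex (\<Union>N)"
  shows "geometric_realization (Nrv Union K) homotopy_equivalent_space
         top_of_set (\<Union>N\<in>K. \<Union>N)"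
proof (rule nerve_closed_convex_cover)
  \<comment> \<open>A common point of the ribbons in \<open>N\<close> lies in their union because
    \<open>N\<close> itself is nonempty.\<close>
  show "\<Union>N \<noteq> {}" if "N \<in> K" for N
    using assms(5)[OF that] by (auto simp: ribbon_nerve_def)
qed (use assms in auto)

end
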